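(* Let $d \geq 2$ be an integer. Then a real polynomial $P \in \mathbb{R}[X]$ belongs to $\mathscr{E}_d$ if and only if there exists $\alpha \in \mathbb{R}[X]$, satisfying $\alpha(-1) = \alpha(-2) = \dots = \alpha(-d+1) = 0$, such that $$P(X) = \alpha(X) + \alpha(X - 1) + \dots + \alpha(X - d + 1) .$$
   Context: Here $\mathbb{N} = \{0, 1, 2, \dots\}$. For a positive integer $d$, $\mathscr{E}_d$ denotes the set (an $\mathbb{R}$-linear subspace of $\mathbb{R}[X]$) of all polynomials $P \in \mathbb{R}[X]$ for which the sum $P(n) + P(n-d) + P(n-2d) + \cdots := \sum_{0 \leq k \leq n/d} P(n - k d)$ (the sum over integers $k \ge 0$ with $n - kd \geq 0$) is polynomial in $n \in \mathbb{N}$, i.e. there exists $S \in \mathbb{R}[X]$ such that this sum equals $S(n)$ for all $n \in \mathbb{N}$. *)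

theory Defs
  imports Complex_Main "HOL-Computational_Algebra.Polynomial"
begin

text \<open>The integers \<open>k\<close> with \<open>0 \<le> k \<le> n/d\<close> are those with \<open>k \<le> n div d\<close>. Only positive \<open>d\<close> is meaningful.\<close>

definition E_space :: "nat \<Rightarrow> real poly set" where
  "E_space d = {P. \<exists>S :: real poly. \<forall>n :: nat.
     (\<Sum>k\<le>n div d. poly P (real n - real k * real d)) = poly S (real n)}"

end

theory Submission
  imports Defs
begin

text \<open>Everything passes through the discrete antiderivative: \<open>\<alpha>(X) = S(X) - S(X - 1)\<close> turns
  \<open>\<alpha>(X) + \<dots> + \<alpha>(X - d + 1)\<close> into \<open>S(X) - S(X - d)\<close>. If \<open>P(X) = S(X) - S(X - d)\<close>, the sum
  \<open>P(n) + P(n - d) + \<dots>\<close> telescopes to \<open>S(n) - S(r - d)\<close> with \<open>r = n mod d\<close>, so it equals \<open>S(n)\<close>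
  precisely when \<open>S\<close> vanishes at \<open>-1, \<dots>, -d\<close>; up to the additive constant in \<open>S\<close> this says that
  \<open>\<alpha>\<close> vanishes at \<open>-1, \<dots>, -d + 1\<close>.\<close>

text \<open>A nonzero difference has only finitely many roots. This lifts identities known only at
  natural arguments, as \<open>E_space\<close> supplies them, to polynomial identities.\<close>

lemma poly_eq_if_eq_on_nats:
  fixes p q :: "'a :: {comm_ring_1,ring_no_zero_divisors,ring_char_0} poly"
  assumes "\<And>n :: nat. poly p (of_nat n) = poly q (of_nat n)"
  shows "p = q"
proof (rule ccontr)
  assume "p \<noteq> q"
  then have "finite {x. poly (p - q) x = 0}"
    by (intro poly_roots_finite) simp
  moreover have "range (of_nat :: nat \<Rightarrow> 'a) \<subseteq> {x. poly (p - q) x = 0}"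
    using assms by auto
  ultimately have "finite (range (of_nat :: nat \<Rightarrow> 'a))"
    using finite_subset by blast
  then show False
    using finite_imageD inj_of_nat by blast
qed

text \<open>The rising factorials form a basis on which the backward difference acts as the derivative
  does on monomials. The factor \<open>pochhammer x a\<close> lets the degree of \<open>p\<close> drop in the induction,
  via \<open>p = (X + a) q + c\<close>.\<close>

lemma backward_antidifference_pochhammer:
  fixes p :: "'a :: field_char_0 poly"
  shows "\<exists>S. \<forall>x. poly S x - poly S (x - 1) = poly p x * pochhammer x a"
proof (induction "degree p" arbitrary: p a rule: less_induct)
  case less
  define c where "c = poly p (- of_nat a)"
  define q where "q = synthetic_div p (- of_nat a)"
  have p: "poly p x = (x + of_nat a) * poly q x + c" for x
  proof -
    have "poly p x = poly ([:of_nat a, 1:] * q + [:c:]) x"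
      using synthetic_div_correct'[of "- of_nat a" p] by (simp add: c_def q_def)
    then show ?thesis
      by (simp add: algebra_simps)
  qed
  \<comment> \<open>For constant \<open>p\<close> the degree cannot drop, but then
    \<open>q = 0\<close> and \<open>T = 0\<close> serves.\<close>
  obtain T where T: "poly T x - poly T (x - 1) = poly q x * pochhammer x (Suc a)" for x
  proof (cases "degree p = 0")
    case True
    then have "q = 0"
      by (simp add: q_def synthetic_div_eq_0_iff)
    then show ?thesis
      by (intro that[of 0]) simp
  next
    case False
    then show ?thesis
      using less[of q "Suc a"] that by (auto simp: q_def degree_synthetic_div)
  qed
  \<comment> \<open>The rising factorial of length \<open>a + 1\<close> as a polynomial: its
    difference is \<open>a + 1\<close> times \<open>pochhammer x a\<close>, so the multiple
    \<open>c / (a + 1)\<close> of it accounts for the remainder \<open>c\<close>.\<close>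
  define R where "R = (\<Prod>i\<le>a. [:of_nat i, 1 :: 'a:])"
  have R: "poly R x = pochhammer x (Suc a)" for x
    by (simp add: R_def poly_prod pochhammer_prod lessThan_Suc_atMost atLeast0LessThan add.commute
        del: pochhammer_Suc)
  have dR: "poly R x - poly R (x - 1) = of_nat (Suc a) * pochhammer x a" for x
  proof -
    have "poly R x = pochhammer x a * (x + of_nat a)"
      by (simp add: R pochhammer_Suc)
    moreover have "poly R (x - 1) = (x - 1) * pochhammer x a"
      by (simp add: R pochhammer_rec)
    ultimately show ?thesis
      by (simp add: algebra_simps)
  qed
  show ?case
  proof (intro exI allI)
    fix x
    let ?k = "c / of_nat (Suc a)"
    have "poly (T + smult ?k R) x - poly (T + smult ?k R) (x - 1) =
        (poly T x - poly T (x - 1)) + ?k * (poly R x - poly R (x - 1))"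
      by (simp add: algebra_simps)
    also have "?k * (poly R x - poly R (x - 1)) = c * pochhammer x a"
      unfolding dR by (simp del: of_nat_Suc)
    finally show "poly (T + smult ?k R) x - poly (T + smult ?k R) (x - 1) =
        poly p x * pochhammer x a"
      by (simp add: T p pochhammer_Suc algebra_simps)
  qed
qed

text \<open>The case \<open>a = 0\<close>; the free additive constant is spent on a zero at
  \<open>c\<close>.\<close>

corollary backward_antidifference:
  fixes p :: "'a :: field_char_0 poly"
  obtains S where "\<And>x. poly S x - poly S (x - 1) = poly p x" "poly S c = 0"
proof -
  obtain T where T: "\<And>x. poly T x - poly T (x - 1) = poly p x"
    using backward_antidifference_pochhammer[of p 0] by auto
  show thesis
    by (rule that[of "T - [:poly T c:]"]) (simp_all add: T)
qed

lemma sum_backward_difference: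
  fixes f :: "'a :: real_vector \<Rightarrow> 'b :: ab_group_add"
  shows "(\<Sum>k\<le>m. f (x - real k *\<^sub>R h) - f (x - real k *\<^sub>R h - h)) = f x - f (x - real (Suc m) *\<^sub>R h)"
  using sum_telescope[of "\<lambda>k. f (x - real k *\<^sub>R h)" m] by (simp add: algebra_simps)

lemma poly_sum_shifts_antidifference:
  fixes \<alpha> S :: "real poly"
  assumes "d \<ge> 1" and S: "\<And>x. poly S x - poly S (x - 1) = poly \<alpha> x"
  shows "poly (\<Sum>k\<le>d - 1. pcompose \<alpha> [:- real k, 1:]) x = poly S x - poly S (x - real d)"
proof -
  have "poly (\<Sum>k\<le>d - 1. pcompose \<alpha> [:- real k, 1:]) x =
      (\<Sum>k\<le>d - 1. poly S (x - real k) - poly S (x - real k - 1))"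
    by (simp add: poly_sum poly_pcompose S)
  also have "\<dots> = poly S x - poly S (x - real d)"
    using sum_backward_difference[of "poly S" x 1 "d - 1"] assms(1) by simp
  finally show ?thesis .
qed

lemma E_space_iff_difference:
  fixes P :: "real poly"
  assumes "d > 0"
  shows "P \<in> E_space d \<longleftrightarrow> (\<exists>S. (\<forall>x. poly P x = poly S x - poly S (x - real d)) \<and>
    (\<forall>j\<in>{1..d}. poly S (- real j) = 0))"
proof
  assume "P \<in> E_space d"
  then obtain S where
    S: "(\<Sum>k\<le>n div d. poly P (real n - real k * real d)) = poly S (real n)" for n
    by (auto simp: E_space_def)
  \<comment> \<open>Passing from \<open>n\<close> to \<open>n + d\<close> adds exactly one term to
    the sum. The shift by \<open>d\<close> makes the recurrence hold at every natural
    \<open>n\<close>.\<close>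
  have "pcompose P [:real d, 1:] = pcompose S [:real d, 1:] - S"
  proof (rule poly_eq_if_eq_on_nats)
    fix n :: nat
    have "poly S (real (n + d)) =
        (\<Sum>k\<le>Suc (n div d). poly P (real (n + d) - real k * real d))"
      using S[of "n + d"] assms by simp
    also have "\<dots> = poly P (real (n + d)) + (\<Sum>k\<le>n div d. poly P (real n - real k * real d))"
      by (simp add: sum.atMost_Suc_shift algebra_simps del: sum.atMost_Suc)
    finally show "poly (pcompose P [:real d, 1:]) (of_nat n) =
        poly (pcompose S [:real d, 1:] - S) (of_nat n)"
      by (simp add: S poly_pcompose algebra_simps)
  qed
  then have "poly (pcompose P [:real d, 1:]) (x - real d) =
      poly (pcompose S [:real d, 1:] - S) (x - real d)" for x
    by simp
  then have P: "poly P x = poly S x - poly S (x - real d)" for x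
    by (simp add: poly_pcompose)
  \<comment> \<open>At \<open>n = d - j < d\<close> the sum is the single term \<open>P(n)\<close>,
    so \<open>S(n) = P(n) = S(n) - S(-j)\<close>.\<close>
  have "poly S (- real j) = 0" if "j \<in> {1..d}" for j
  proof -
    have "poly P (real (d - j)) = poly S (real (d - j))"
      using S[of "d - j"] that by simp
    then show ?thesis
      using P[of "real (d - j)"] that by (simp add: of_nat_diff)
  qed
  with P show "\<exists>S. (\<forall>x. poly P x = poly S x - poly S (x - real d)) \<and>
      (\<forall>j\<in>{1..d}. poly S (- real j) = 0)"
    by blast
next
  assume "\<exists>S. (\<forall>x. poly P x = poly S x - poly S (x - real d)) \<and>
    (\<forall>j\<in>{1..d}. poly S (- real j) = 0)"
  then obtain S where P: "\<And>x. poly P x = poly S x - poly S (x - real d)"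
    and zero: "\<And>j. j \<in> {1..d} \<Longrightarrow> poly S (- real j) = 0"
    by blast
  have "(\<Sum>k\<le>n div d. poly P (real n - real k * real d)) = poly S (real n)" for n
  proof -
    have "n mod d < d"
      using assms by simp
    have "real n = real (n div d) * real d + real (n mod d)"
      by (metis div_mult_mod_eq of_nat_add of_nat_mult)
    \<comment> \<open>The argument left over after telescoping is \<open>n mod d - d\<close>, one of
      the prescribed zeros of \<open>S\<close>.\<close>
    then have "real n - real (Suc (n div d)) * real d = - real (d - n mod d)"
      using \<open>n mod d < d\<close> by (simp add: of_nat_diff algebra_simps)
    moreover have "d - n mod d \<in> {1..d}"
      using \<open>n mod d < d\<close> by auto
    ultimately have "poly S (real n - real (Suc (n div d)) * real d) = 0"
      using zero by metis
    then show ?thesis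
      using sum_backward_difference[of "poly S" "real n" "real d" "n div d"] by (simp add: P)
  qed
  then show "P \<in> E_space d"
    by (auto simp: E_space_def)
qed

theorem theorem2p7:
  fixes d :: nat and P :: "real poly"
  assumes "d \<ge> 2"
  shows "P \<in> E_space d \<longleftrightarrow>
    (\<exists>\<alpha> :: real poly. (\<forall>j\<in>{1..d - 1}. poly \<alpha> (- real j) = 0) \<and>
       P = (\<Sum>k\<le>d - 1. pcompose \<alpha> [:- real k, 1:]))"
proof
  assume "P \<in> E_space d"
  then obtain S where P: "\<And>x. poly P x = poly S x - poly S (x - real d)"
    and zero: "\<And>j. j \<in> {1..d} \<Longrightarrow> poly S (- real j) = 0"
    using assms by (auto simp: E_space_iff_difference)
  define \<alpha> where "\<alpha> = S - pcompose S [:- 1, 1:]"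
  have \<alpha>: "poly S x - poly S (x - 1) = poly \<alpha> x" for x
    by (simp add: \<alpha>_def poly_pcompose)
  have "P = (\<Sum>k\<le>d - 1. pcompose \<alpha> [:- real k, 1:])"
    using poly_sum_shifts_antidifference[OF _ \<alpha>] assms P by (intro poly_ext) simp
  moreover have "poly \<alpha> (- real j) = 0" if "j \<in> {1..d - 1}" for j
  proof -
    \<comment> \<open>Both terms of \<open>\<alpha>(-j) = S(-j) - S(-j - 1)\<close> vanish.\<close>
    have "j \<in> {1..d}" "Suc j \<in> {1..d}"
      using that assms by auto
    moreover have "- real j - 1 = - real (Suc j)"
      by simp
    ultimately show ?thesis
      using zero \<alpha>[of "- real j"] by (metis diff_0_right)
  qed
  ultimately show "\<exists>\<alpha>. (\<forall>j\<in>{1..d - 1}. poly \<alpha> (- real j) = 0) \<and>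
      P = (\<Sum>k\<le>d - 1. pcompose \<alpha> [:- real k, 1:])"
    by blast
next
  assume "\<exists>\<alpha>. (\<forall>j\<in>{1..d - 1}. poly \<alpha> (- real j) = 0) \<and>
    P = (\<Sum>k\<le>d - 1. pcompose \<alpha> [:- real k, 1:])"
  then obtain \<alpha> where zero: "\<And>j. j \<in> {1..d - 1} \<Longrightarrow> poly \<alpha> (- real j) = 0"
    and P: "P = (\<Sum>k\<le>d - 1. pcompose \<alpha> [:- real k, 1:])"
    by blast
  obtain S where S: "\<And>x. poly S x - poly S (x - 1) = poly \<alpha> x" and S1: "poly S (- 1) = 0"
    by (rule backward_antidifference[of \<alpha> "- 1"]) blast
  \<comment> \<open>The zero at \<open>-1\<close> spreads leftwards through
    \<open>S(-j - 1) = S(-j) - \<alpha>(-j)\<close>; the \<open>d - 1\<close> zeros of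
    \<open>\<alpha>\<close> carry it exactly to \<open>-d\<close>.\<close>
  have "poly S (- real j) = 0" if "1 \<le> j" "j \<le> d" for j
    using that
  proof (induction j rule: dec_induct)
    case base
    show ?case
      using S1 by simp
  next
    case (step j)
    moreover from step have "poly \<alpha> (- real j) = 0"
      by (intro zero) auto
    ultimately have "poly S (- real j - 1) = 0"
      using S[of "- real j"] by simp
    moreover have "- real (Suc j) = - real j - 1"
      by simp
    ultimately show ?case
      by metis
  qed
  moreover have "poly P x = poly S x - poly S (x - real d)" for x
    unfolding P using assms S by (intro poly_sum_shifts_antidifference) auto
  ultimately show "P \<in> E_space d"
    using assms by (auto simp: E_space_iff_difference)
qed

end
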